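(* There exists a subnormal $2$-variable weighted shift $(T_1,T_2)$ with $2$-atomic Berger measure such that: (i) $(T_1^2,T_2)$ is spherically quasinormal; (ii) $(T_1,T_2^2)$ is spherically quasinormal; and (iii) $(T_1,T_2)$ is not spherically quasinormal.
   Context: Let $\mathbb{Z}_+=\{0,1,2,\dots\}$, let $\{e_{\mathbf{k}}\}_{\mathbf{k}\in\mathbb{Z}_+^2}$ be the canonical orthonormal basis of $\ell^2(\mathbb{Z}_+^2)$, and let $\varepsilon_1=(1,0)$, $\varepsilon_2=(0,1)$. Given bounded families of positive real numbers $\alpha=\{\alpha_{\mathbf{k}}\}$, $\beta=\{\beta_{\mathbf{k}}\}$ ($\mathbf{k}\in\mathbb{Z}_+^2$), the $2$-variable weighted shift $W_{(\alpha,\beta)}\equiv(T_1,T_2)$ is the pair of bounded operators on $\ell^2(\mathbb{Z}_+^2)$ given by $T_1e_{\mathbf{k}}=\alpha_{\mathbf{k}}e_{\mathbf{k}+\varepsilon_1}$ and $T_2e_{\mathbf{k}}=\beta_{\mathbf{k}}e_{\mathbf{k}+\varepsilon_2}$. All $2$-variable weighted shifts are assumed commuting: $T_1T_2=T_2T_1$, i.e. $\beta_{\mathbf{k}+\varepsilon_1}\alpha_{\mathbf{k}}=\alpha_{\mathbf{k}+\varepsilon_2}\beta_{\mathbf{k}}$ for all $\mathbf{k}$. The moments are $\gamma_{(0,0)}=1$ and, for $\mathbf{k}=(k_1,k_2)$, $\gamma_{\mathbf{k}}=\prod_{i=0}^{k_1-1}\alpha_{(i,0)}^2\prod_{j=0}^{k_2-1}\beta_{(k_1,j)}^2$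 (empty products equal $1$). A pair is subnormal if it is the restriction of a commuting pair of normal operators (on a larger Hilbert space) to a common invariant subspace. By Berger's theorem, $(T_1,T_2)$ is subnormal if and only if there is a probability measure $\mu$ on $[0,\|T_1\|^2]\times[0,\|T_2\|^2]$ with $\gamma_{\mathbf{k}}=\int s^{k_1}t^{k_2}\,d\mu(s,t)$ for all $\mathbf{k}\in\mathbb{Z}_+^2$ (convention $0^0=1$); $\mu$ is called the Berger measure. It is $2$-atomic if it is supported on exactly two points. A commuting pair $(S_1,S_2)$ of bounded operators is spherically quasinormal if each of $S_1,S_2$ commutes with $S_1^*S_1+S_2^*S_2$. *)

theory Defs
  imports "HOL-Probability.Probability"
begin

section \<open>The complex Hilbert space of square-summable families\<close>

typedef 'i ell2 = "{f :: 'i \<Rightarrow> complex. (\<lambda>i. (cmod (f i))\<^sup>2) summable_on UNIV}"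
  morphisms coord Abs_ell2
  by (intro exI[of _ "\<lambda>_. 0"]) simp

setup_lifting type_definition_ell2

lemma summable_coord: "(\<lambda>i. (cmod (coord x i))\<^sup>2) summable_on UNIV"
  using coord by auto

lemma square_summable_add:
  fixes f g :: "'i \<Rightarrow> complex"
  assumes f: "(\<lambda>i. (cmod (f i))\<^sup>2) summable_on UNIV"
    and g: "(\<lambda>i. (cmod (g i))\<^sup>2) summable_on UNIV"
  shows "(\<lambda>i. (cmod (f i + g i))\<^sup>2) summable_on UNIV"
proof (rule summable_on_comparison_test)
  show "(\<lambda>i. 2 * (cmod (f i))\<^sup>2 + 2 * (cmod (g i))\<^sup>2) summable_on UNIV"
    by (intro summable_on_add summable_on_cmult_right f g)
next
  fix i
  have "(cmod (f i + g i))\<^sup>2 \<le> (cmod (f i) + cmod (g i))\<^sup>2"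
    by (simp add: norm_triangle_ineq power_mono)
  also have "\<dots> \<le> 2 * (cmod (f i))\<^sup>2 + 2 * (cmod (g i))\<^sup>2"
    using sum_squares_bound[of "cmod (f i)" "cmod (g i)"] by (simp add: power2_sum)
  finally show "(cmod (f i + g i))\<^sup>2 \<le> 2 * (cmod (f i))\<^sup>2 + 2 * (cmod (g i))\<^sup>2" .
qed auto

lemma square_summable_scale:
  fixes f :: "'i \<Rightarrow> complex"
  assumes "(\<lambda>i. (cmod (f i))\<^sup>2) summable_on UNIV"
  shows "(\<lambda>i. (cmod (c * f i))\<^sup>2) summable_on UNIV"
  using summable_on_cmult_right[OF assms, of "(cmod c)\<^sup>2"]
  by (simp add: norm_mult power_mult_distrib)

lift_definition scaleC :: "complex \<Rightarrow> 'i ell2 \<Rightarrow> 'i ell2" (infixr \<open>*\<^sub>C\<close> 75)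
  is "\<lambda>c f i. c * f i"
  by (rule square_summable_scale)

definition cinner :: "'i ell2 \<Rightarrow> 'i ell2 \<Rightarrow> complex"
  where "cinner x y = (\<Sum>\<^sub>\<infinity>i. coord x i * cnj (coord y i))"

lemma cinner_summable:
  "(\<lambda>i. coord x i * cnj (coord y i)) summable_on UNIV"
proof (rule abs_summable_summable, rule summable_on_comparison_test)
  show "(\<lambda>i. (cmod (coord x i))\<^sup>2 + (cmod (coord y i))\<^sup>2) summable_on UNIV"
    by (intro summable_on_add summable_coord)
next
  fix i
  have "2 * (cmod (coord x i) * cmod (coord y i)) \<le> (cmod (coord x i))\<^sup>2 + (cmod (coord y i))\<^sup>2"
    using sum_squares_bound[of "cmod (coord x i)" "cmod (coord y i)"] by simp
  moreover have "0 \<le> cmod (coord x i) * cmod (coord y i)" by simp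
  ultimately have "cmod (coord x i) * cmod (coord y i) \<le> (cmod (coord x i))\<^sup>2 + (cmod (coord y i))\<^sup>2"
    by linarith
  then show "norm (coord x i * cnj (coord y i)) \<le> (cmod (coord x i))\<^sup>2 + (cmod (coord y i))\<^sup>2"
    by (simp add: norm_mult)
qed auto

instantiation ell2 :: (type) real_vector
begin

lift_definition zero_ell2 :: "'a ell2" is "\<lambda>_. 0" by simp

lift_definition plus_ell2 :: "'a ell2 \<Rightarrow> 'a ell2 \<Rightarrow> 'a ell2" is "\<lambda>f g i. f i + g i"
  by (rule square_summable_add)

lift_definition uminus_ell2 :: "'a ell2 \<Rightarrow> 'a ell2" is "\<lambda>f i. - f i" by simp

lift_definition minus_ell2 :: "'a ell2 \<Rightarrow> 'a ell2 \<Rightarrow> 'a ell2" is "\<lambda>f g i. f i - g i"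
  using square_summable_add[of _ "\<lambda>i. - g i" for g] by auto

definition scaleR_ell2 :: "real \<Rightarrow> 'a ell2 \<Rightarrow> 'a ell2"
  where "scaleR_ell2 r x = complex_of_real r *\<^sub>C x"

instance
proof
  fix x y z :: "'a ell2" and r s :: real
  show "x + y + z = x + (y + z)" by transfer (simp add: add.assoc)
  show "x + y = y + x" by transfer (simp add: add.commute)
  show "0 + x = x" by transfer simp
  show "- x + x = 0" by transfer simp
  show "x - y = x + - y" by transfer simp
  show "r *\<^sub>R (x + y) = r *\<^sub>R x + r *\<^sub>R y"
    unfolding scaleR_ell2_def by transfer (simp add: distrib_left)
  show "(r + s) *\<^sub>R x = r *\<^sub>R x + s *\<^sub>R x"
    unfolding scaleR_ell2_def by transfer (simp add: distrib_right)
  show "r *\<^sub>R s *\<^sub>R x = (r * s) *\<^sub>R x"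
    unfolding scaleR_ell2_def by transfer (simp add: mult.assoc)
  show "1 *\<^sub>R x = x"
    unfolding scaleR_ell2_def by transfer simp
qed

end

instantiation ell2 :: (type) real_inner
begin

definition inner_ell2 :: "'a ell2 \<Rightarrow> 'a ell2 \<Rightarrow> real"
  where "inner_ell2 x y = Re (cinner x y)"

definition norm_ell2 :: "'a ell2 \<Rightarrow> real"
  where "norm_ell2 x = sqrt (inner x x)"

definition dist_ell2 :: "'a ell2 \<Rightarrow> 'a ell2 \<Rightarrow> real"
  where "dist_ell2 x y = norm (x - y)"

definition sgn_ell2 :: "'a ell2 \<Rightarrow> 'a ell2"
  where "sgn_ell2 x = x /\<^sub>R norm x"

definition uniformity_ell2 :: "('a ell2 \<times> 'a ell2) filter"
  where "uniformity_ell2 = (INF e\<in>{0 <..}. principal {(x, y). dist x y < e})"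

definition open_ell2 :: "'a ell2 set \<Rightarrow> bool"
  where "open_ell2 S = (\<forall>x\<in>S. \<forall>\<^sub>F (x', y) in uniformity. x' = x \<longrightarrow> y \<in> S)"

lemma inner_self_ell2: "inner x x = (\<Sum>\<^sub>\<infinity>i. (cmod (coord x i))\<^sup>2)" for x :: "'a ell2"
proof -
  have "((\<lambda>i. coord x i * cnj (coord x i)) has_sum cinner x x) UNIV"
    unfolding cinner_def using cinner_summable by (rule has_sum_infsum)
  from has_sum_Re[OF this] have "((\<lambda>i. (cmod (coord x i))\<^sup>2) has_sum inner x x) UNIV"
    by (simp add: inner_ell2_def cmod_power2 flip: power2_eq_square)
  from infsumI[OF this] show ?thesis by (rule sym)
qed

instance
proof
  fix x y z :: "'a ell2" and r s :: real and U :: "'a ell2 set"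
  show "dist x y = norm (x - y)" by (rule dist_ell2_def)
  show "sgn x = x /\<^sub>R norm x" by (rule sgn_ell2_def)
  show "uniformity = (INF e\<in>{0 <..}. principal {(x :: 'a ell2, y). dist x y < e})"
    by (rule uniformity_ell2_def)
  show "open U = (\<forall>x\<in>U. \<forall>\<^sub>F (x', y) in uniformity. x' = x \<longrightarrow> y \<in> U)"
    by (rule open_ell2_def)
  have "cinner y x = cnj (cinner x y)"
    unfolding cinner_def by (subst infsum_cnj[symmetric]) (simp add: mult.commute)
  then show "inner x y = inner y x" by (simp add: inner_ell2_def)
  have "cinner (x + y) z = cinner x z + cinner y z"
    unfolding cinner_def
    by (subst infsum_add[symmetric]) (auto simp: cinner_summable plus_ell2.rep_eq distrib_right)
  then show "inner (x + y) z = inner x z + inner y z" by (simp add: inner_ell2_def)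
  have "cinner (r *\<^sub>R x) y = of_real r * cinner x y"
    unfolding cinner_def scaleR_ell2_def
    by (subst infsum_cmult_right'[symmetric]) (simp add: scaleC.rep_eq mult.assoc)
  then show "inner (r *\<^sub>R x) y = r * inner x y" by (simp add: inner_ell2_def)
  have eq': "inner x x = (\<Sum>\<^sub>\<infinity>i. (cmod (coord x i))\<^sup>2)"
    by (rule inner_self_ell2)
  show "0 \<le> inner x x" unfolding eq' by (rule infsum_nonneg) simp
  show "(inner x x = 0) = (x = 0)"
  proof
    assume "inner x x = 0"
    then have "(cmod (coord x i))\<^sup>2 = 0" for i
      unfolding eq' by (rule nonneg_infsum_le_0D[OF eq_refl]) (auto simp: summable_coord)
    then have "coord x = coord 0" by (simp add: zero_ell2.rep_eq fun_eq_iff)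
    then show "x = 0" by (rule coord_inject[THEN iffD1])
  next
    assume "x = 0"
    then show "inner x x = 0" unfolding eq' by (simp add: zero_ell2.rep_eq)
  qed
  show "norm x = sqrt (inner x x)" by (rule norm_ell2_def)
qed

end

lemma norm_ell2_squared: "(norm x)\<^sup>2 = (\<Sum>\<^sub>\<infinity>i. (cmod (coord x i))\<^sup>2)" for x :: "'i ell2"
  by (rule trans[OF power2_norm_eq_inner inner_self_ell2])

lemma sum_coord_le_norm: "finite F \<Longrightarrow> (\<Sum>i\<in>F. (cmod (coord x i))\<^sup>2) \<le> (norm x)\<^sup>2"
  unfolding norm_ell2_squared by (rule finite_sum_le_infsum[OF summable_coord]) auto

instance ell2 :: (type) complete_space
proof
  fix X :: "nat \<Rightarrow> 'a ell2"
  assume X: "Cauchy X"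
  have le: "cmod (coord (X m) i - coord (X n) i) \<le> norm (X m - X n)" for m n i
    using sum_coord_le_norm[of "{i}" "X m - X n"]
    by (simp add: minus_ell2.rep_eq)
  have "Cauchy (\<lambda>n. coord (X n) i)" for i
  proof (rule metric_CauchyI)
    fix e :: real
    assume "0 < e"
    with X obtain M where "\<forall>m\<ge>M. \<forall>n\<ge>M. dist (X m) (X n) < e"
      by (meson metric_CauchyD)
    then have "\<forall>m\<ge>M. \<forall>n\<ge>M. dist (coord (X m) i) (coord (X n) i) < e"
      unfolding dist_norm by (auto intro: le_less_trans[OF le])
    then show "\<exists>M. \<forall>m\<ge>M. \<forall>n\<ge>M. dist (coord (X m) i) (coord (X n) i) < e" ..
  qed
  then have "\<forall>i. \<exists>l. (\<lambda>n. coord (X n) i) \<longlonglongrightarrow> l"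
    by (simp add: Cauchy_convergent_iff convergent_def)
  then obtain f where f: "(\<lambda>n. coord (X n) i) \<longlonglongrightarrow> f i" for i
    by metis
  have fin: "(\<Sum>i\<in>F. (cmod (coord (X m) i - f i))\<^sup>2) \<le> e\<^sup>2"
    if M: "\<forall>m\<ge>M. \<forall>n\<ge>M. dist (X m) (X n) < e" and "m \<ge> M" and "finite F" for e M m F
  proof (rule tendsto_upperbound)
    show "(\<lambda>n. \<Sum>i\<in>F. (cmod (coord (X m) i - coord (X n) i))\<^sup>2)
        \<longlonglongrightarrow> (\<Sum>i\<in>F. (cmod (coord (X m) i - f i))\<^sup>2)"
      by (intro tendsto_intros f)
    show "\<forall>\<^sub>F n in sequentially. (\<Sum>i\<in>F. (cmod (coord (X m) i - coord (X n) i))\<^sup>2) \<le> e\<^sup>2"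
      unfolding eventually_sequentially
    proof (intro exI allI impI)
      fix n
      assume "n \<ge> M"
      then have "dist (X m) (X n) < e"
        using M \<open>m \<ge> M\<close> by blast
      then have "norm (X m - X n) \<le> e"
        by (simp add: dist_norm)
      then have "(norm (X m - X n))\<^sup>2 \<le> e\<^sup>2"
        by (simp add: power_mono)
      then show "(\<Sum>i\<in>F. (cmod (coord (X m) i - coord (X n) i))\<^sup>2) \<le> e\<^sup>2"
        using sum_coord_le_norm[OF \<open>finite F\<close>, of "X m - X n"]
        by (simp add: minus_ell2.rep_eq)
    qed
  qed simp
  have diff: "(\<lambda>i. (cmod (coord (X m) i - f i))\<^sup>2) summable_on UNIV"
    if M: "\<forall>m\<ge>M. \<forall>n\<ge>M. dist (X m) (X n) < e" and "m \<ge> M" for e M m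
  proof (rule nonneg_bdd_above_summable_on)
    show "bdd_above (sum (\<lambda>i. (cmod (coord (X m) i - f i))\<^sup>2) ` {F. F \<subseteq> UNIV \<and> finite F})"
      using fin[OF that] by (intro bdd_aboveI2[where M = "e\<^sup>2"]) blast
  qed simp
  obtain M1 where M1: "\<forall>m\<ge>M1. \<forall>n\<ge>M1. dist (X m) (X n) < 1"
    using X by (meson metric_CauchyD zero_less_one)
  have "(\<lambda>i. (cmod (f i - coord (X M1) i))\<^sup>2) summable_on UNIV"
    using diff[OF M1 order_refl] by (simp add: norm_minus_commute)
  from square_summable_add[OF this summable_coord[of "X M1"]]
  have "(\<lambda>i. (cmod (f i))\<^sup>2) summable_on UNIV"
    by simp
  then obtain x where x: "coord x = f"
    using Abs_ell2_inverse[of f] by blast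
  have "X \<longlonglongrightarrow> x"
  proof (rule metric_LIMSEQ_I)
    fix e :: real
    assume e: "0 < e"
    then obtain M where M: "\<forall>m\<ge>M. \<forall>n\<ge>M. dist (X m) (X n) < e / 2"
      using X by (meson half_gt_zero metric_CauchyD)
    have "dist (X m) x < e" if "m \<ge> M" for m
    proof -
      have "(norm (X m - x))\<^sup>2 \<le> (e / 2)\<^sup>2"
        unfolding norm_ell2_squared
      proof (rule infsum_le_finite_sums[OF summable_coord])
        fix F :: "'a set"
        assume "finite F"
        from fin[OF M that this]
        show "(\<Sum>i\<in>F. (cmod (coord (X m - x) i))\<^sup>2) \<le> (e / 2)\<^sup>2"
          by (simp add: minus_ell2.rep_eq x)
      qed
      then have "norm (X m - x) \<le> e / 2"
        by (rule power2_le_imp_le) (use e in simp)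
      then show ?thesis
        using e by (simp add: dist_norm)
    qed
    then show "\<exists>M. \<forall>m\<ge>M. dist (X m) x < e" by blast
  qed
  then show "convergent X" unfolding convergent_def by blast
qed

lift_definition basis_vec :: "'i \<Rightarrow> 'i ell2" is "\<lambda>k i. if i = k then 1 else 0"
proof (rule finite_nonzero_values_imp_summable_on)
  fix k :: 'i
  have "{i \<in> UNIV. (cmod (if i = k then 1 else 0))\<^sup>2 \<noteq> 0} \<subseteq> {k}"
    by (auto split: if_splits)
  then show "finite {i \<in> UNIV. (cmod (if i = k then 1 else 0))\<^sup>2 \<noteq> 0}"
    by (rule finite_subset) simp
qed


section \<open>Bounded operators\<close>

definition bounded_clinear :: "('i ell2 \<Rightarrow> 'j ell2) \<Rightarrow> bool"
  where "bounded_clinear A \<longleftrightarrow> bounded_linear A \<and> (\<forall>c x. A (c *\<^sub>C x) = c *\<^sub>C A x)"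

(* By the Riesz representation theorem the described operator exists whenever A is bounded. *)
definition adj :: "('i ell2 \<Rightarrow> 'j ell2) \<Rightarrow> ('j ell2 \<Rightarrow> 'i ell2)"
  where "adj A = (THE B. \<forall>x y. cinner (A x) y = cinner x (B y))"

definition normal_op :: "('i ell2 \<Rightarrow> 'i ell2) \<Rightarrow> bool"
  where "normal_op N \<longleftrightarrow> bounded_clinear N \<and> adj N \<circ> N = N \<circ> adj N"

definition commuting_pair :: "('i ell2 \<Rightarrow> 'i ell2) \<Rightarrow> ('i ell2 \<Rightarrow> 'i ell2) \<Rightarrow> bool"
  where "commuting_pair S1 S2 \<longleftrightarrow>
    bounded_clinear S1 \<and> bounded_clinear S2 \<and> S1 \<circ> S2 = S2 \<circ> S1"

(* The larger Hilbert space is that of square-summable families over 'i \<times> nat, and the original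
   space is identified with the range of the isometry V, which is then invariant under N1 and N2.
   This loses no generality: a minimal commuting normal extension acts on a space of Hilbert
   dimension at most max(card 'i, aleph_0), and adding zero operators on an orthogonal complement
   brings the dimension up to that of 'i \<times> nat. *)
definition subnormal_pair :: "('i ell2 \<Rightarrow> 'i ell2) \<Rightarrow> ('i ell2 \<Rightarrow> 'i ell2) \<Rightarrow> bool"
  where "subnormal_pair S1 S2 \<longleftrightarrow>
    (\<exists>(N1 :: ('i \<times> nat) ell2 \<Rightarrow> ('i \<times> nat) ell2) N2 (V :: 'i ell2 \<Rightarrow> ('i \<times> nat) ell2).
       normal_op N1 \<and> normal_op N2 \<and> commuting_pair N1 N2 \<and>
       bounded_clinear V \<and> (\<forall>x. norm (V x) = norm x) \<and>
       N1 \<circ> V = V \<circ> S1 \<and> N2 \<circ> V = V \<circ> S2)"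

definition spherically_quasinormal :: "('i ell2 \<Rightarrow> 'i ell2) \<Rightarrow> ('i ell2 \<Rightarrow> 'i ell2) \<Rightarrow> bool"
  where "spherically_quasinormal S1 S2 \<longleftrightarrow>
    commuting_pair S1 S2 \<and>
    (let P = (\<lambda>x. adj S1 (S1 x) + adj S2 (S2 x)) in S1 \<circ> P = P \<circ> S1 \<and> S2 \<circ> P = P \<circ> S2)"


section \<open>Two-variable weighted shifts\<close>

type_synonym weights = "nat \<times> nat \<Rightarrow> real"

definition two_variable_weighted_shift ::
  "weights \<Rightarrow> weights \<Rightarrow> ((nat \<times> nat) ell2 \<Rightarrow> (nat \<times> nat) ell2) \<Rightarrow>
   ((nat \<times> nat) ell2 \<Rightarrow> (nat \<times> nat) ell2) \<Rightarrow> bool"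
  where "two_variable_weighted_shift \<alpha> \<beta> T1 T2 \<longleftrightarrow>
    (\<forall>k. \<alpha> k > 0) \<and> (\<forall>k. \<beta> k > 0) \<and> bounded (range \<alpha>) \<and> bounded (range \<beta>) \<and>
    (\<forall>k1 k2. T1 (basis_vec (k1, k2)) = \<alpha> (k1, k2) *\<^sub>R basis_vec (k1 + 1, k2)) \<and>
    (\<forall>k1 k2. T2 (basis_vec (k1, k2)) = \<beta> (k1, k2) *\<^sub>R basis_vec (k1, k2 + 1)) \<and>
    commuting_pair T1 T2"

definition moment :: "weights \<Rightarrow> weights \<Rightarrow> nat \<times> nat \<Rightarrow> real"
  where "moment \<alpha> \<beta> = (\<lambda>(k1, k2). (\<Prod>i<k1. (\<alpha> (i, 0))\<^sup>2) * (\<Prod>j<k2. (\<beta> (k1, j))\<^sup>2))"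

definition berger_measure ::
  "weights \<Rightarrow> weights \<Rightarrow> ((nat \<times> nat) ell2 \<Rightarrow> (nat \<times> nat) ell2) \<Rightarrow>
   ((nat \<times> nat) ell2 \<Rightarrow> (nat \<times> nat) ell2) \<Rightarrow> (real \<times> real) measure \<Rightarrow> bool"
  where "berger_measure \<alpha> \<beta> T1 T2 \<mu> \<longleftrightarrow>
    prob_space \<mu> \<and> sets \<mu> = sets borel \<and>
    measure \<mu> ({0..(onorm T1)\<^sup>2} \<times> {0..(onorm T2)\<^sup>2}) = 1 \<and>
    (\<forall>k1 k2. has_bochner_integral \<mu> (\<lambda>(s, t). s ^ k1 * t ^ k2) (moment \<alpha> \<beta> (k1, k2)))"

definition two_atomic :: "(real \<times> real) measure \<Rightarrow> bool"
  where "two_atomic \<mu> \<longleftrightarrow>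
    (\<exists>A. card A = 2 \<and> measure \<mu> A = 1 \<and> (\<forall>p\<in>A. measure \<mu> {p} > 0))"

end

(* Let the Berger measure be the mean of the point masses at (s j, t j), j = 0, 1. The weights at k
   are square roots of ratios of moments, so S1* S1 + S2* S2 for (T1^2, T2) is diagonal with entry
   the average of s^2 + t against s^k1 t^k2; it is a scalar operator as soon as s^2 + t takes the
   same value at both atoms. Likewise (T1, T2^2) only needs s + t^2 to agree at both atoms. For
   distinct atoms the two conditions amount to s0^2 + t0 = s1^2 + t1 and (s0 + s1)(t0 + t1) = 1,
   which leaves room for s + t to differ: take (17/16, 1/8) and (15/16, 3/8). *)

theory Submission
  imports Defs "HOL-Library.Nat_Bijection"
begin

section \<open>Coordinates, basis vectors and adjoints\<close>

lemma ell2_eqI: "(\<And>i. coord x i = coord y i) \<Longrightarrow> x = y"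
  using coord_inject by blast

lemma coord_scaleR: "coord (r *\<^sub>R x) i = of_real r * coord x i"
  by (simp add: scaleR_ell2_def scaleC.rep_eq)

lemma cinner_basis_vec: "cinner (basis_vec k) y = cnj (coord y k)"
proof -
  have "cinner (basis_vec k) y = (\<Sum>\<^sub>\<infinity>i\<in>{k}. cnj (coord y i))"
    unfolding cinner_def by (rule infsum_cong_neutral) (auto simp: basis_vec.rep_eq)
  then show ?thesis by simp
qed

lemma norm_basis_vec: "norm (basis_vec k) = 1"
proof -
  have "(norm (basis_vec k))\<^sup>2 = 1"
    unfolding power2_norm_eq_inner inner_ell2_def cinner_basis_vec
    by (simp add: basis_vec.rep_eq)
  then show ?thesis by (simp add: power2_eq_1_iff) (use norm_ge_zero[of "basis_vec k"] in linarith)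
qed

text \<open>Since \<open>adj\<close> is a definite description, uniqueness matters too: pairing with
  basis vectors recovers every coordinate of \<open>B y\<close>.\<close>

lemma adj_eqI:
  assumes "\<And>x y. cinner (A x) y = cinner x (B y)"
  shows "adj A = B"
  unfolding adj_def
proof (rule the_equality)
  show "\<forall>x y. cinner (A x) y = cinner x (B y)" using assms by blast
next
  fix B' assume B': "\<forall>x y. cinner (A x) y = cinner x (B' y)"
  have "coord (B' y) k = coord (B y) k" for y k
    using assms[of "basis_vec k" y] B'[rule_format, of "basis_vec k" y]
    by (simp add: cinner_basis_vec)
  then show "B' = B" by (auto intro!: ext ell2_eqI)
qed

section \<open>Weighted shifts along an injection\<close>

text \<open>A general index map \<open>f\<close> lets one operator cover the unilateral shifts,
  their compositions, the bilateral shifts of the normal extension and the embeddings into it. If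
  \<open>f\<close> is injective and \<open>w\<close> bounded, the family is square-summable, so
  \<open>Abs_ell2\<close> is meaningful.\<close>

definition wshift :: "('i \<Rightarrow> 'j) \<Rightarrow> ('i \<Rightarrow> real) \<Rightarrow> 'i ell2 \<Rightarrow> 'j ell2" where
  "wshift f w x = Abs_ell2 (\<lambda>j. if j \<in> range f then w (inv f j) * coord x (inv f j) else 0)"

text \<open>This is the adjoint of \<open>wshift f w\<close>; the weights are real, so no conjugate
  appears.\<close>

definition wpull :: "('i \<Rightarrow> 'j) \<Rightarrow> ('i \<Rightarrow> real) \<Rightarrow> 'j ell2 \<Rightarrow> 'i ell2" where
  "wpull f w y = Abs_ell2 (\<lambda>i. w i * coord y (f i))"

lemma square_summable_weighted:
  fixes g :: "'i \<Rightarrow> complex" and w :: "'i \<Rightarrow> real"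
  assumes "bounded (range w)" and g: "(\<lambda>i. (cmod (g i))\<^sup>2) summable_on UNIV"
  shows "(\<lambda>i. (cmod (w i * g i))\<^sup>2) summable_on UNIV"
proof -
  obtain M where M: "\<And>i. \<bar>w i\<bar> \<le> M" using assms(1) by (auto simp: bounded_iff)
  show ?thesis
  proof (rule summable_on_comparison_test)
    show "(\<lambda>i. M\<^sup>2 * (cmod (g i))\<^sup>2) summable_on UNIV"
      by (intro summable_on_cmult_right g)
    fix i
    have "(w i)\<^sup>2 \<le> M\<^sup>2" using M[of i] by (simp add: abs_le_square_iff[symmetric])
    then show "(cmod (w i * g i))\<^sup>2 \<le> M\<^sup>2 * (cmod (g i))\<^sup>2"
      by (simp add: norm_mult power_mult_distrib mult_right_mono)
  qed auto
qed

text \<open>Injectivity of \<open>f\<close> keeps the pulled-back family square-summable: it meets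
  each coordinate of \<open>y\<close> over \<open>range f\<close> exactly once.\<close>

lemma coord_wpull:
  assumes "inj f" and "bounded (range w)"
  shows "coord (wpull f w y) i = w i * coord y (f i)"
proof -
  have "(\<lambda>j. (cmod (coord y j))\<^sup>2) summable_on range f"
    by (rule summable_on_subset_banach[OF summable_coord]) simp
  then have "(\<lambda>i. (cmod (coord y (f i)))\<^sup>2) summable_on UNIV"
    by (simp add: summable_on_reindex[OF assms(1)] o_def)
  from square_summable_weighted[OF assms(2) this]
  show ?thesis unfolding wpull_def by (subst Abs_ell2_inverse) auto
qed

context
  fixes f :: "'i \<Rightarrow> 'j" and w :: "'i \<Rightarrow> real"
  assumes inj: "inj f" and bdd: "bounded (range w)"
begin

lemma coord_wshift':
  "coord (wshift f w x) j = (if j \<in> range f then w (inv f j) * coord x (inv f j) else 0)"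
proof -
  have "(\<lambda>j. (cmod (if j \<in> range f then w (inv f j) * coord x (inv f j) else 0))\<^sup>2) summable_on range f"
    unfolding summable_on_reindex[OF inj]
    using square_summable_weighted[OF bdd summable_coord] by (simp add: o_def inj)
  then have "(\<lambda>j. (cmod (if j \<in> range f then w (inv f j) * coord x (inv f j) else 0))\<^sup>2) summable_on UNIV"
    by (rule summable_on_cong_neutral[THEN iffD1, rotated -1]) auto
  then show ?thesis unfolding wshift_def by (subst Abs_ell2_inverse) auto
qed

lemma coord_wshift: "coord (wshift f w x) (f i) = w i * coord x i"
  by (simp add: coord_wshift' inj)

lemma coord_wshift_notin: "j \<notin> range f \<Longrightarrow> coord (wshift f w x) j = 0"
  by (simp add: coord_wshift')

lemma wshift_basis_vec: "wshift f w (basis_vec i) = w i *\<^sub>R basis_vec (f i)"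
  by (rule ell2_eqI)
    (auto simp: coord_wshift' coord_scaleR basis_vec.rep_eq inv_f_f[OF inj] inj_eq[OF inj])

text \<open>Only \<open>range f\<close> contributes to the left-hand sum, and reindexing it along
  \<open>f\<close> moves the weight onto \<open>y\<close>.\<close>

lemma cinner_wshift: "cinner (wshift f w x) y = cinner x (wpull f w y)"
proof -
  have "cinner (wshift f w x) y
      = (\<Sum>\<^sub>\<infinity>j\<in>range f. coord (wshift f w x) j * cnj (coord y j))"
    unfolding cinner_def by (rule infsum_cong_neutral) (auto simp: coord_wshift_notin)
  also have "\<dots> = (\<Sum>\<^sub>\<infinity>i. coord (wshift f w x) (f i) * cnj (coord y (f i)))"
    by (subst infsum_reindex[OF inj]) (simp add: o_def)
  also have "\<dots> = cinner x (wpull f w y)"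
    unfolding cinner_def
    by (intro infsum_cong) (simp add: coord_wshift coord_wpull[OF inj bdd])
  finally show ?thesis .
qed

lemma adj_wshift: "adj (wshift f w) = wpull f w"
  by (rule adj_eqI) (rule cinner_wshift)

text \<open>The adjoint times the shift is diagonal in the standard basis; this reduces spherical
  quasinormality to a condition on weights.\<close>

lemma coord_wpull_wshift: "coord (wpull f w (wshift f w x)) i = (w i)\<^sup>2 * coord x i"
  by (simp add: coord_wpull[OF inj bdd] coord_wshift power2_eq_square mult.assoc)

lemma norm_wshift_squared: "(norm (wshift f w x))\<^sup>2 = (\<Sum>\<^sub>\<infinity>i. (w i)\<^sup>2 * (cmod (coord x i))\<^sup>2)"
proof -
  have "(norm (wshift f w x))\<^sup>2 = (\<Sum>\<^sub>\<infinity>j\<in>range f. (cmod (coord (wshift f w x) j))\<^sup>2)"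
    unfolding norm_ell2_squared by (rule infsum_cong_neutral) (auto simp: coord_wshift_notin)
  also have "\<dots> = (\<Sum>\<^sub>\<infinity>i. (w i)\<^sup>2 * (cmod (coord x i))\<^sup>2)"
    by (subst infsum_reindex[OF inj]) (simp add: o_def coord_wshift norm_mult power_mult_distrib)
  finally show ?thesis .
qed

lemma summable_weighted_coord: "(\<lambda>i. (w i)\<^sup>2 * (cmod (coord x i))\<^sup>2) summable_on UNIV"
  using square_summable_weighted[OF bdd summable_coord[of x]]
  by (simp add: norm_mult power_mult_distrib)

lemma bounded_clinear_wshift: "bounded_clinear (wshift f w)"
proof -
  obtain M where M: "\<And>i. \<bar>w i\<bar> \<le> M" using bdd by (auto simp: bounded_iff)
  have "M \<ge> 0" using M[of undefined] by linarith
  have "bounded_linear (wshift f w)"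
  proof (rule bounded_linear_intro)
    fix x y :: "'i ell2" and r :: real
    show "wshift f w (x + y) = wshift f w x + wshift f w y"
      by (rule ell2_eqI) (simp add: coord_wshift' plus_ell2.rep_eq distrib_left)
    show "wshift f w (r *\<^sub>R x) = r *\<^sub>R wshift f w x"
      by (rule ell2_eqI) (simp add: coord_wshift' coord_scaleR)
    have "(norm (wshift f w x))\<^sup>2 \<le> (\<Sum>\<^sub>\<infinity>i. M\<^sup>2 * (cmod (coord x i))\<^sup>2)"
      unfolding norm_wshift_squared
    proof (rule infsum_mono)
      fix i
      have "(w i)\<^sup>2 \<le> M\<^sup>2" using M[of i] by (simp add: abs_le_square_iff[symmetric])
      then show "(w i)\<^sup>2 * (cmod (coord x i))\<^sup>2 \<le> M\<^sup>2 * (cmod (coord x i))\<^sup>2"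
        by (simp add: mult_right_mono)
    qed (auto intro: summable_weighted_coord summable_on_cmult_right summable_coord)
    also have "\<dots> = (norm x * M)\<^sup>2"
      unfolding power_mult_distrib norm_ell2_squared
      by (subst infsum_cmult_right') simp
    finally show "norm (wshift f w x) \<le> norm x * M"
      by (rule power2_le_imp_le) (simp add: \<open>M \<ge> 0\<close>)
  qed
  moreover have "wshift f w (c *\<^sub>C x) = c *\<^sub>C wshift f w x" for c x
    by (rule ell2_eqI) (simp add: coord_wshift' scaleC.rep_eq)
  ultimately show ?thesis by (simp add: bounded_clinear_def)
qed

end

section \<open>Composition, commutation and normality of weighted shifts\<close>

lemma bounded_range_comp: "bounded (range w) \<Longrightarrow> bounded (range (\<lambda>i. w (g i)))"
  by (erule bounded_subset) auto

lemma bounded_range_mult: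
  fixes v w :: "'i \<Rightarrow> real"
  assumes "bounded (range v)" and "bounded (range w)"
  shows "bounded (range (\<lambda>i. v i * w i))"
proof -
  obtain A B where "\<And>i. \<bar>v i\<bar> \<le> A" "\<And>i. \<bar>w i\<bar> \<le> B" using assms by (auto simp: bounded_iff)
  then have "\<bar>v i * w i\<bar> \<le> A * B" for i
    unfolding abs_mult by (intro mult_mono) (auto intro: order_trans[OF abs_ge_zero])
  then show ?thesis by (auto simp: bounded_iff)
qed

text \<open>The cases are whether \<open>j\<close> pulls back through both maps, through
  \<open>f\<close> only, or not at all; in the last two both sides vanish.\<close>

lemma wshift_comp:
  assumes f: "inj f" "bounded (range w)" and g: "inj g" "bounded (range v)"
  shows "wshift f w \<circ> wshift g v = wshift (f \<circ> g) (\<lambda>i. w (g i) * v i)"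
proof (rule ext, rule ell2_eqI)
  fix x j
  note fg = inj_compose[OF f(1) g(1)]
    bounded_range_mult[OF bounded_range_comp[OF f(2)] g(2)]
  consider i where "j = f (g i)" | k where "j = f k" "k \<notin> range g" | "j \<notin> range f"
    by blast
  then show "coord ((wshift f w \<circ> wshift g v) x) j
      = coord (wshift (f \<circ> g) (\<lambda>i. w (g i) * v i) x) j"
  proof cases
    case 1
    then show ?thesis
      using coord_wshift[OF fg, where x = x and i = i] by (simp add: coord_wshift[OF f] coord_wshift[OF g])
  next
    case 2
    then have "j \<notin> range (f \<circ> g)" using f(1) by (auto dest: injD)
    then show ?thesis
      using 2 by (simp add: coord_wshift[OF f] coord_wshift_notin[OF g] coord_wshift_notin[OF fg])
  next
    case 3
    then have "j \<notin> range (f \<circ> g)" by auto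
    then show ?thesis
      using 3 by (simp add: coord_wshift_notin[OF f] coord_wshift_notin[OF fg])
  qed
qed

lemma commuting_pair_wshift:
  assumes f: "inj f" "bounded (range w)" and g: "inj g" "bounded (range v)"
    and "f \<circ> g = g \<circ> f" and "\<And>i. w (g i) * v i = v (f i) * w i"
  shows "commuting_pair (wshift f w) (wshift g v)"
  using assms(5,6)
  by (simp add: commuting_pair_def bounded_clinear_wshift[OF f] bounded_clinear_wshift[OF g]
      wshift_comp[OF f g] wshift_comp[OF g f])

text \<open>For bijective \<open>f\<close> both products with the adjoint are diagonal. Their
  entries at \<open>f i\<close> are the squares of \<open>w (f i)\<close> and of \<open>w i\<close>,
  so weights constant along orbits give normality.\<close>

lemma normal_op_wshift:
  assumes f: "bij f" "bounded (range w)" and inv: "\<And>i. w (f i) = w i"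
  shows "normal_op (wshift f w)"
proof -
  note f' = bij_is_inj[OF f(1)] f(2)
  have "coord (wpull f w (wshift f w x)) j = coord (wshift f w (wpull f w x)) j" for x j
  proof -
    obtain i where "j = f i" using f(1) by (metis bij_pointE)
    then show ?thesis
      by (simp add: coord_wpull_wshift[OF f'] coord_wshift[OF f'] coord_wpull[OF f'] inv
          power2_eq_square)
  qed
  then show ?thesis
    unfolding normal_op_def adj_wshift[OF f']
    by (auto intro!: ext ell2_eqI bounded_clinear_wshift[OF f'])
qed

section \<open>Spherical quasinormality and isometries in terms of weights\<close>

lemma coord_spherical_wshift:
  assumes f: "inj f" "bounded (range w)" and g: "inj g" "bounded (range v)"
  shows "coord (adj (wshift f w) (wshift f w x) + adj (wshift g v) (wshift g v x)) i
    = complex_of_real ((w i)\<^sup>2 + (v i)\<^sup>2) * coord x i"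
  by (simp add: adj_wshift[OF f] adj_wshift[OF g] plus_ell2.rep_eq
      coord_wpull_wshift[OF f] coord_wpull_wshift[OF g] distrib_right)

text \<open>A constant diagonal makes the operator in question the scalar \<open>c\<close>, which
  commutes with every linear operator.\<close>

lemma spherically_quasinormal_wshift:
  assumes f: "inj f" "bounded (range w)" and g: "inj g" "bounded (range v)"
    and comm: "commuting_pair (wshift f w) (wshift g v)"
    and const: "\<And>i. (w i)\<^sup>2 + (v i)\<^sup>2 = c"
  shows "spherically_quasinormal (wshift f w) (wshift g v)"
proof -
  have P: "(\<lambda>x. adj (wshift f w) (wshift f w x) + adj (wshift g v) (wshift g v x)) = (\<lambda>x. c *\<^sub>R x)"
    by (rule ext, rule ell2_eqI)
      (simp only: coord_spherical_wshift[OF f g] const coord_scaleR)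
  have "bounded_linear (wshift f w)" "bounded_linear (wshift g v)"
    using bounded_clinear_wshift[OF f] bounded_clinear_wshift[OF g]
    by (auto simp: bounded_clinear_def)
  then show ?thesis
    unfolding spherically_quasinormal_def Let_def P
    by (simp add: comm fun_eq_iff linear_simps)
qed

text \<open>Commutation is tested on \<open>basis_vec i\<close> in coordinate \<open>f i\<close>:
  one order picks up the diagonal entry at \<open>i\<close>, the other the entry at
  \<open>f i\<close>, and the common factor \<open>w i\<close> cancels.\<close>

lemma spherically_quasinormal_wshiftD:
  assumes f: "inj f" "bounded (range w)" and g: "inj g" "bounded (range v)"
    and "spherically_quasinormal (wshift f w) (wshift g v)" and "w i \<noteq> 0"
  shows "(w (f i))\<^sup>2 + (v (f i))\<^sup>2 = (w i)\<^sup>2 + (v i)\<^sup>2"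
proof -
  define P where "P = (\<lambda>x. adj (wshift f w) (wshift f w x) + adj (wshift g v) (wshift g v x))"
  have P: "coord (P x) k = complex_of_real ((w k)\<^sup>2 + (v k)\<^sup>2) * coord x k" for x k
    unfolding P_def by (rule coord_spherical_wshift[OF f g])
  have "wshift f w \<circ> P = P \<circ> wshift f w"
    using assms(5) by (simp add: spherically_quasinormal_def Let_def P_def)
  then have "coord (wshift f w (P (basis_vec i))) (f i) = coord (P (wshift f w (basis_vec i))) (f i)"
    by (metis comp_apply)
  then have "complex_of_real ((w (f i))\<^sup>2 + (v (f i))\<^sup>2) = complex_of_real ((w i)\<^sup>2 + (v i)\<^sup>2)"
    using assms(6) by (simp add: P coord_wshift[OF f] basis_vec.rep_eq)
  then show ?thesis by (simp only: of_real_eq_iff)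
qed

text \<open>Disjoint ranges make the two images orthogonal, so Pythagoras applies. This yields the
  isometry into the normal extension.\<close>

lemma norm_wshift_add_orthogonal:
  assumes f: "inj f" "bounded (range w)" and g: "inj g" "bounded (range v)"
    and disj: "range f \<inter> range g = {}" and one: "\<And>i. (w i)\<^sup>2 + (v i)\<^sup>2 = 1"
  shows "norm (wshift f w x + wshift g v x) = norm x"
proof -
  have "cinner (wshift f w x) (wshift g v x) = 0"
    unfolding cinner_def
  proof (rule infsum_0)
    fix j
    show "coord (wshift f w x) j * cnj (coord (wshift g v x) j) = 0"
      using disj coord_wshift_notin[OF f, of j] coord_wshift_notin[OF g, of j] by fastforce
  qed
  then have "inner (wshift f w x) (wshift g v x) = 0" by (simp add: inner_ell2_def)
  then have "(norm (wshift f w x + wshift g v x))\<^sup>2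
      = (norm (wshift f w x))\<^sup>2 + (norm (wshift g v x))\<^sup>2"
    by (simp add: power2_norm_eq_inner inner_add_left inner_add_right inner_commute)
  also have "\<dots> = (\<Sum>\<^sub>\<infinity>i. (w i)\<^sup>2 * (cmod (coord x i))\<^sup>2 + (v i)\<^sup>2 * (cmod (coord x i))\<^sup>2)"
    unfolding norm_wshift_squared[OF f] norm_wshift_squared[OF g]
    by (intro infsum_add[symmetric] summable_weighted_coord[OF f] summable_weighted_coord[OF g])
  also have "\<dots> = (norm x)\<^sup>2"
    unfolding norm_ell2_squared distrib_right[symmetric] one by simp
  finally show ?thesis by simp
qed

lemma bounded_clinear_add:
  assumes "bounded_clinear A" and "bounded_clinear B"
  shows "bounded_clinear (\<lambda>x. A x + B x)"
proof -
  have "c *\<^sub>C x + c *\<^sub>C y = c *\<^sub>C (x + y)" for c and x y :: "'b ell2"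
    by (rule ell2_eqI) (simp add: scaleC.rep_eq plus_ell2.rep_eq distrib_left)
  then show ?thesis
    using assms by (simp add: bounded_clinear_def bounded_linear_add)
qed

section \<open>The weighted shift of a two-atomic measure\<close>

abbreviation right :: "nat \<times> nat \<Rightarrow> nat \<times> nat" where "right \<equiv> map_prod Suc id"
abbreviation up :: "nat \<times> nat \<Rightarrow> nat \<times> nat" where "up \<equiv> map_prod id Suc"

text \<open>These are the moments of the measure with mass 1/2 at each point
  \<open>(s j, t j)\<close>; \<open>bool\<close> indexes the atoms.\<close>

definition two_atomic_moment :: "(bool \<Rightarrow> real) \<Rightarrow> (bool \<Rightarrow> real) \<Rightarrow> weights" where
  "two_atomic_moment s t k = (\<Sum>j\<in>UNIV. s j ^ fst k * t j ^ snd k) / 2"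

lemma inj_right: "inj right" and inj_up: "inj up"
  by (auto intro!: prod.inj_map)

text \<open>Iterating the bound on \<open>g\<close> gives \<open>a ^ n \<le> C * g 0 * B ^ n\<close>
  for all \<open>n\<close>, impossible if \<open>a / B > 1\<close>. With \<open>g\<close> the
  moments along an axis, this will confine the atoms to the rectangle given by the operator
  norms.\<close>

lemma growth_rate_le:
  fixes a B C :: real and g :: "nat \<Rightarrow> real"
  assumes "a > 0" and "B > 0" and "C \<ge> 0"
    and a: "\<And>n. a ^ n \<le> C * g n" and B: "\<And>n. g (Suc n) \<le> B * g n"
  shows "a \<le> B"
proof (rule ccontr)
  assume "\<not> a \<le> B"
  then have "1 < a / B" using assms by simp
  then obtain n where n: "C * g 0 < (a / B) ^ n" using real_arch_pow by blast
  have "g n \<le> g 0 * B ^ n"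
  proof (induction n)
    case (Suc n)
    have "g (Suc n) \<le> B * g n" by (rule B)
    also have "\<dots> \<le> B * (g 0 * B ^ n)" using Suc.IH \<open>B > 0\<close> by simp
    finally show ?case by (simp add: mult_ac)
  qed simp
  then have "C * g n \<le> C * (g 0 * B ^ n)" using \<open>C \<ge> 0\<close> by (rule mult_left_mono)
  then show False
    using n a[of n] \<open>B > 0\<close> by (simp add: power_divide field_simps)
qed

lemma weight_le_onorm_wshift:
  assumes "inj f" and "bounded (range w)" and "0 \<le> w i"
  shows "w i \<le> onorm (wshift f w)"
  using onorm[of "wshift f w" "basis_vec i"] bounded_clinear_wshift[OF assms(1,2)] assms
  by (simp add: bounded_clinear_def wshift_basis_vec norm_basis_vec)

text \<open>Strictly positive coordinates make all moments positive, hence also the weights formed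
  from their ratios.\<close>

locale two_atoms =
  fixes s t :: "bool \<Rightarrow> real"
  assumes s_pos: "s j > 0" and t_pos: "t j > 0"
begin

abbreviation \<gamma> :: weights where "\<gamma> \<equiv> two_atomic_moment s t"

definition \<alpha> :: weights where "\<alpha> k = sqrt (\<gamma> (right k) / \<gamma> k)"
definition \<beta> :: weights where "\<beta> k = sqrt (\<gamma> (up k) / \<gamma> k)"

lemma moment_term_pos: "s j ^ m * t j ^ n > 0"
  by (simp add: s_pos t_pos)

lemma moment_term_le: "s j ^ fst k * t j ^ snd k \<le> 2 * \<gamma> k"
  unfolding two_atomic_moment_def
  using member_le_sum[of j UNIV "\<lambda>j. s j ^ fst k * t j ^ snd k"] moment_term_pos
  by (simp add: less_imp_le)

lemma \<gamma>_pos: "\<gamma> k > 0"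
  unfolding two_atomic_moment_def by (simp add: sum_pos moment_term_pos)

lemma \<gamma>_0: "\<gamma> (0, 0) = 1"
  by (simp add: two_atomic_moment_def)

lemma \<alpha>_pos: "\<alpha> k > 0" and \<beta>_pos: "\<beta> k > 0"
  by (simp_all add: \<alpha>_def \<beta>_def \<gamma>_pos)

lemma \<alpha>_squared: "(\<alpha> k)\<^sup>2 = \<gamma> (right k) / \<gamma> k"
  and \<beta>_squared: "(\<beta> k)\<^sup>2 = \<gamma> (up k) / \<gamma> k"
  by (simp_all add: \<alpha>_def \<beta>_def \<gamma>_pos less_imp_le)

text \<open>An extra factor \<open>s j\<close> costs at most \<open>sum s UNIV\<close>, a crude
  bound that is enough to bound the weights.\<close>

lemma \<gamma>_right_le: "\<gamma> (right k) \<le> sum s UNIV * \<gamma> k"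
proof -
  have "(\<Sum>j\<in>UNIV. s j * (s j ^ fst k * t j ^ snd k))
      \<le> (\<Sum>j\<in>UNIV. sum s UNIV * (s j ^ fst k * t j ^ snd k))"
    by (intro sum_mono mult_right_mono member_le_sum)
      (auto simp: s_pos moment_term_pos less_imp_le)
  then show ?thesis
    by (simp add: two_atomic_moment_def sum_distrib_left[symmetric] mult.assoc)
qed

lemma \<gamma>_up_le: "\<gamma> (up k) \<le> sum t UNIV * \<gamma> k"
proof -
  have "(\<Sum>j\<in>UNIV. t j * (s j ^ fst k * t j ^ snd k))
      \<le> (\<Sum>j\<in>UNIV. sum t UNIV * (s j ^ fst k * t j ^ snd k))"
    by (intro sum_mono mult_right_mono member_le_sum)
      (auto simp: t_pos moment_term_pos less_imp_le)
  then show ?thesis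
    by (simp add: two_atomic_moment_def sum_distrib_left[symmetric] mult.left_commute)
qed

lemma bounded_\<alpha>: "bounded (range \<alpha>)"
proof -
  have "\<alpha> k \<le> sqrt (sum s UNIV)" for k
    unfolding \<alpha>_def by (simp only: real_sqrt_le_iff) (simp add: divide_le_eq \<gamma>_pos \<gamma>_right_le)
  then show ?thesis using \<alpha>_pos by (auto simp: bounded_iff abs_of_pos)
qed

lemma bounded_\<beta>: "bounded (range \<beta>)"
proof -
  have "\<beta> k \<le> sqrt (sum t UNIV)" for k
    unfolding \<beta>_def by (simp only: real_sqrt_le_iff) (simp add: divide_le_eq \<gamma>_pos \<gamma>_up_le)
  then show ?thesis using \<beta>_pos by (auto simp: bounded_iff abs_of_pos)
qed

text \<open>The products of moment ratios telescope, first along the bottom row to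
  \<open>(m, 0)\<close>, then up column \<open>m\<close>.\<close>

lemma moment_eq: "moment \<alpha> \<beta> = \<gamma>"
proof
  fix k :: "nat \<times> nat"
  have "(\<Prod>i<m. (\<alpha> (i, 0))\<^sup>2) = \<gamma> (m, 0)" for m
    by (induction m) (simp_all add: \<gamma>_0 \<alpha>_squared \<gamma>_pos[THEN less_imp_neq, symmetric])
  moreover have "\<gamma> (m, 0) * (\<Prod>j<n. (\<beta> (m, j))\<^sup>2) = \<gamma> (m, n)" for m n
    by (induction n)
      (simp_all add: \<beta>_squared \<gamma>_pos[THEN less_imp_neq, symmetric] mult.assoc[symmetric])
  ultimately show "moment \<alpha> \<beta> k = \<gamma> k"
    by (cases k) (simp add: moment_def)
qed

section \<open>The shift pair, its norms and its Berger measure\<close>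

abbreviation "T1 \<equiv> wshift right \<alpha>"
abbreviation "T2 \<equiv> wshift up \<beta>"

lemmas right_\<alpha> = inj_right bounded_\<alpha>
lemmas up_\<beta> = inj_up bounded_\<beta>

lemma right_up: "right (up k) = up (right k)"
  by (cases k) simp

text \<open>Both sides are the square root of \<open>\<gamma> (right (up k)) / \<gamma> k\<close>:
  on either path the intermediate moment cancels.\<close>

lemma \<alpha>_\<beta>_commute: "\<alpha> (up k) * \<beta> k = \<beta> (right k) * \<alpha> k"
  by (simp add: \<alpha>_def \<beta>_def real_sqrt_mult[symmetric] right_up
      \<gamma>_pos[THEN less_imp_neq, symmetric])

lemma commuting_pair_T: "commuting_pair T1 T2"
  by (rule commuting_pair_wshift[OF right_\<alpha> up_\<beta>])
    (auto simp: fun_eq_iff right_up \<alpha>_\<beta>_commute)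

lemma T1_T2_commute: "T1 \<circ> T2 = T2 \<circ> T1"
  using commuting_pair_T by (simp only: commuting_pair_def)

lemma two_variable_weighted_shift_T: "two_variable_weighted_shift \<alpha> \<beta> T1 T2"
  by (simp add: two_variable_weighted_shift_def \<alpha>_pos \<beta>_pos bounded_\<alpha> bounded_\<beta> commuting_pair_T
      wshift_basis_vec[OF right_\<alpha>] wshift_basis_vec[OF up_\<beta>])

text \<open>No weight exceeds the norm of \<open>T1\<close>, so each step to the right multiplies
  the moment by at most the squared norm. The moments along the bottom row grow at least like the
  powers of \<open>s j\<close>.\<close>

lemma s_le_onorm: "s j \<le> (onorm T1)\<^sup>2"
proof -
  have le: "\<alpha> k \<le> onorm T1" for k
    by (rule weight_le_onorm_wshift[OF right_\<alpha>]) (simp add: \<alpha>_pos less_imp_le)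
  have pos: "onorm T1 > 0" using le[of "(0, 0)"] \<alpha>_pos[of "(0, 0)"] by linarith
  have step: "\<gamma> (right k) \<le> (onorm T1)\<^sup>2 * \<gamma> k" for k
    using power_mono[OF le[of k], of 2] \<alpha>_pos[of k] \<gamma>_pos[of k]
    by (simp add: \<alpha>_squared divide_le_eq less_imp_le)
  show ?thesis
  \<comment> \<open>The constant 2 compensates the mass 1/2 of the atom.\<close>
  proof (rule growth_rate_le[where C = 2 and g = "\<lambda>n. \<gamma> (n, 0)"])
    fix n
    show "s j ^ n \<le> 2 * \<gamma> (n, 0)" using moment_term_le[of j "(n, 0)"] by simp
    show "\<gamma> (Suc n, 0) \<le> (onorm T1)\<^sup>2 * \<gamma> (n, 0)"
      using step[of "(n, 0)"] by (simp only: map_prod_simp id_apply)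
  qed (use pos in \<open>simp_all add: s_pos\<close>)
qed

lemma t_le_onorm: "t j \<le> (onorm T2)\<^sup>2"
proof -
  have le: "\<beta> k \<le> onorm T2" for k
    by (rule weight_le_onorm_wshift[OF up_\<beta>]) (simp add: \<beta>_pos less_imp_le)
  have pos: "onorm T2 > 0" using le[of "(0, 0)"] \<beta>_pos[of "(0, 0)"] by linarith
  have step: "\<gamma> (up k) \<le> (onorm T2)\<^sup>2 * \<gamma> k" for k
    using power_mono[OF le[of k], of 2] \<beta>_pos[of k] \<gamma>_pos[of k]
    by (simp add: \<beta>_squared divide_le_eq less_imp_le)
  show ?thesis
  proof (rule growth_rate_le[where C = 2 and g = "\<lambda>n. \<gamma> (0, n)"])
    fix n
    show "t j ^ n \<le> 2 * \<gamma> (0, n)" using moment_term_le[of j "(0, n)"] by simp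
    show "\<gamma> (0, Suc n) \<le> (onorm T2)\<^sup>2 * \<gamma> (0, n)"
      using step[of "(0, n)"] by (simp only: map_prod_simp id_apply)
  qed (use pos in \<open>simp_all add: t_pos\<close>)
qed

definition \<mu> :: "(real \<times> real) measure" where
  "\<mu> = distr (measure_pmf (pmf_of_set UNIV)) borel (\<lambda>j. (s j, t j))"

lemma measure_\<mu>:
  "A \<in> sets borel \<Longrightarrow> measure \<mu> A = real (card {j. (s j, t j) \<in> A}) / 2"
  unfolding \<mu>_def by (subst measure_distr) (auto simp: measure_pmf_of_set vimage_def)

lemma berger_measure_\<mu>: "berger_measure \<alpha> \<beta> T1 T2 \<mu>"
proof -
  have "prob_space \<mu>"
    unfolding \<mu>_def by (rule measure_pmf.prob_space_distr) simp
  moreover have "measure \<mu> ({0..(onorm T1)\<^sup>2} \<times> {0..(onorm T2)\<^sup>2}) = 1"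
    by (subst measure_\<mu>)
      (auto simp: s_le_onorm t_le_onorm s_pos t_pos less_imp_le borel_closed closed_Times)
  moreover have "has_bochner_integral \<mu> (\<lambda>(x, y). x ^ m * y ^ n) (\<gamma> (m, n))" for m n
    unfolding \<mu>_def
  proof (rule has_bochner_integral_distr)
    show "has_bochner_integral (measure_pmf (pmf_of_set UNIV))
        (\<lambda>j. case (s j, t j) of (x, y) \<Rightarrow> x ^ m * y ^ n) (\<gamma> (m, n))"
      unfolding has_bochner_integral_iff
      by (auto simp: integral_pmf_of_set two_atomic_moment_def intro: integrable_measure_pmf_finite)
  qed (auto simp: case_prod_beta intro!: borel_measurable_continuous_onI continuous_intros)
  ultimately show ?thesis
    by (simp add: berger_measure_def moment_eq) (simp add: \<mu>_def)
qed

lemma two_atomic_\<mu>: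
  assumes "s True \<noteq> s False"
  shows "two_atomic \<mu>"
  unfolding two_atomic_def
proof (intro exI conjI)
  let ?A = "{(s True, t True), (s False, t False)}"
  show "card ?A = 2" using assms by simp
  have "(s j, t j) \<in> ?A" for j by (cases j) auto
  then show "measure \<mu> ?A = 1"
    by (subst measure_\<mu>) auto
  have "measure \<mu> {(s j, t j)} > 0" for j
    by (subst measure_\<mu>) (auto simp: card_gt_0_iff)
  then show "\<forall>p\<in>?A. measure \<mu> {p} > 0" by auto
qed

section \<open>Subnormality through a commuting normal extension\<close>

text \<open>The normal extension acts on \<open>\<ell>\<^sup>2(\<int> \<times> \<int> \<times> bool)\<close> by bilateral shifts, with constant
  weights \<open>sqrt (s j)\<close> and \<open>sqrt (t j)\<close> on the layer of atom \<open>j\<close>; the integers are encoded in \<open>nat\<close>.\<close>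

definition shift1 :: "(nat \<times> nat) \<times> nat \<Rightarrow> (nat \<times> nat) \<times> nat" where
  "shift1 = map_prod (map_prod (\<lambda>n. int_encode (int_decode n + 1)) id) id"

definition shift2 :: "(nat \<times> nat) \<times> nat \<Rightarrow> (nat \<times> nat) \<times> nat" where
  "shift2 = map_prod (map_prod id (\<lambda>n. int_encode (int_decode n + 1))) id"

text \<open>The quadrant sits inside the encoded integer lattice, on layer 0 for the atom
  \<open>True\<close> and on layer 1 for \<open>False\<close>.\<close>

definition emb :: "bool \<Rightarrow> nat \<times> nat \<Rightarrow> (nat \<times> nat) \<times> nat" where
  "emb j k = ((int_encode (int (fst k)), int_encode (int (snd k))), if j then 0 else 1)"

text \<open>The square is the share of atom \<open>j\<close> in the moment
  \<open>\<gamma> k\<close>: a basis vector is spread over the two layers in these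
  proportions.\<close>

definition emb_weight :: "bool \<Rightarrow> weights" where
  "emb_weight j k = sqrt (s j ^ fst k * t j ^ snd k / (2 * \<gamma> k))"

lemma bij_int_encode_succ: "bij (\<lambda>n. int_encode (int_decode n + 1))"
  by (rule bij_betw_byWitness[where f' = "\<lambda>n. int_encode (int_decode n - 1)"]) auto

lemma bij_map_prod: "bij f \<Longrightarrow> bij g \<Longrightarrow> bij (map_prod f g)"
  using bij_betw_map_prod[of f UNIV UNIV g UNIV UNIV] by simp

lemma bij_shift1: "bij shift1" and bij_shift2: "bij shift2"
  unfolding shift1_def shift2_def
  by (simp_all add: bij_map_prod bij_int_encode_succ)

lemma shift1_emb: "shift1 \<circ> emb j = emb j \<circ> right"
  and shift2_emb: "shift2 \<circ> emb j = emb j \<circ> up"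
  by (auto simp: shift1_def shift2_def emb_def fun_eq_iff algebra_simps)

lemma inj_emb: "inj (emb j)"
  by (rule injI) (auto simp: emb_def prod_eq_iff int_encode_eq)

lemma emb_weight_le_1: "\<bar>emb_weight j k\<bar> \<le> 1"
  using moment_term_le[of j k] \<gamma>_pos[of k] moment_term_pos[of j "fst k" "snd k"]
  by (simp add: emb_weight_def)

lemma bounded_emb_weight: "bounded (range (emb_weight j))"
  using emb_weight_le_1 by (auto simp: bounded_iff)

text \<open>This is the weight identity behind \<open>N1 \<circ> V = V \<circ> T1\<close>; the
  moment at \<open>right k\<close> cancels on the right-hand side.\<close>

lemma emb_weight_right: "sqrt (s j) * emb_weight j k = emb_weight j (right k) * \<alpha> k"
  using \<gamma>_pos[of "right k"]
  by (simp add: emb_weight_def \<alpha>_def real_sqrt_mult[symmetric] mult_ac)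

lemma emb_weight_up: "sqrt (t j) * emb_weight j k = emb_weight j (up k) * \<beta> k"
  using \<gamma>_pos[of "up k"]
  by (simp add: emb_weight_def \<beta>_def real_sqrt_mult[symmetric] mult_ac)

lemma emb_weight_sum: "(emb_weight True k)\<^sup>2 + (emb_weight False k)\<^sup>2 = 1"
  using \<gamma>_pos[of k] moment_term_pos[of _ "fst k" "snd k"]
  by (simp add: emb_weight_def less_imp_le add_divide_distrib[symmetric])
    (simp add: two_atomic_moment_def UNIV_bool)

lemma bounded_atom_weight: "bounded (range (\<lambda>p. sqrt (r (snd p = 0))))" for r :: "bool \<Rightarrow> real"
  by (rule bounded_subset[of "range (\<lambda>j. sqrt (r j))"]) (auto simp: finite_imp_bounded)

lemma subnormal_pair_T: "subnormal_pair T1 T2"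
proof -
  \<comment> \<open>The test \<open>snd p = 0\<close> reads the atom off the layer; every layer
    other than 0 carries the value for \<open>False\<close>. The index maps preserve layers, so the
    weights are constant along orbits. The range of \<open>V\<close> lies in layers 0 and 1.\<close>
  define N1 where "N1 = wshift shift1 (\<lambda>p. sqrt (s (snd p = 0)))"
  define N2 where "N2 = wshift shift2 (\<lambda>p. sqrt (t (snd p = 0)))"
  define W where "W j = wshift (emb j) (emb_weight j)" for j
  define V where "V x = W True x + W False x" for x
  note n1 = bij_is_inj[OF bij_shift1] bounded_atom_weight[of s]
  note n2 = bij_is_inj[OF bij_shift2] bounded_atom_weight[of t]
  note e = inj_emb bounded_emb_weight
  have "normal_op N1" unfolding N1_def
    by (rule normal_op_wshift[OF bij_shift1 bounded_atom_weight]) (simp add: shift1_def)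
  moreover have "normal_op N2" unfolding N2_def
    by (rule normal_op_wshift[OF bij_shift2 bounded_atom_weight]) (simp add: shift2_def)
  moreover have "commuting_pair N1 N2" unfolding N1_def N2_def
    by (rule commuting_pair_wshift[OF n1 n2]) (auto simp: shift1_def shift2_def)
  moreover have "bounded_clinear V"
    unfolding V_def W_def by (intro bounded_clinear_add bounded_clinear_wshift e)
  \<comment> \<open>The two images lie on different layers, and the shares of the atoms add up to
    1.\<close>
  moreover have "norm (V x) = norm x" for x
    unfolding V_def W_def
    by (rule norm_wshift_add_orthogonal[OF e e]) (auto simp: emb_def emb_weight_sum)
  moreover have "N1 \<circ> V = V \<circ> T1"
  proof -
    \<comment> \<open>On each layer both sides are weighted shifts with the same index map and the
      same weights.\<close>
    have "N1 \<circ> W j = W j \<circ> T1" for j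
      unfolding N1_def W_def wshift_comp[OF n1 e] wshift_comp[OF e right_\<alpha>] shift1_emb
      by (simp add: emb_def emb_weight_right)
    then have "N1 (W j x) = W j (T1 x)" for j x by (metis comp_apply)
    moreover have "N1 (x + y) = N1 x + N1 y" for x y
      using \<open>normal_op N1\<close> by (simp add: normal_op_def bounded_clinear_def linear_simps)
    ultimately show ?thesis by (simp add: V_def fun_eq_iff)
  qed
  moreover have "N2 \<circ> V = V \<circ> T2"
  proof -
    have "N2 \<circ> W j = W j \<circ> T2" for j
      unfolding N2_def W_def wshift_comp[OF n2 e] wshift_comp[OF e up_\<beta>] shift2_emb
      by (simp add: emb_def emb_weight_up)
    then have "N2 (W j x) = W j (T2 x)" for j x by (metis comp_apply)
    moreover have "N2 (x + y) = N2 x + N2 y" for x y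
      using \<open>normal_op N2\<close> by (simp add: normal_op_def bounded_clinear_def linear_simps)
    ultimately show ?thesis by (simp add: V_def fun_eq_iff)
  qed
  ultimately show ?thesis unfolding subnormal_pair_def by blast
qed

section \<open>Spherical quasinormality after squaring one component\<close>

lemma spherically_quasinormal_T1_squared:
  assumes "\<And>j. (s j)\<^sup>2 + t j = c"
  shows "spherically_quasinormal (T1 \<circ> T1) T2"
proof -
  note r = inj_compose[OF inj_right inj_right]
    bounded_range_mult[OF bounded_range_comp[OF bounded_\<alpha>] bounded_\<alpha>]
  \<comment> \<open>Rebracketing to the right and then to the left lets \<open>T2\<close> pass one
    factor \<open>T1\<close> at a time.\<close>
  have "T1 \<circ> T1 \<circ> T2 = T2 \<circ> (T1 \<circ> T1)"
    by (simp only: comp_assoc T1_T2_commute) (simp only: comp_assoc[symmetric] T1_T2_commute)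
  then have comm: "commuting_pair (T1 \<circ> T1) T2"
    by (simp add: commuting_pair_def wshift_comp[OF right_\<alpha> right_\<alpha>] bounded_clinear_wshift[OF r]
        bounded_clinear_wshift[OF up_\<beta>])
  \<comment> \<open>The squared weights of the composite telescope to
    \<open>\<gamma> (right (right k)) / \<gamma> k\<close>, so the sum is an average of the values
    of \<open>s^2 + t\<close> at the atoms.\<close>
  have "(\<alpha> (right k) * \<alpha> k)\<^sup>2 + (\<beta> k)\<^sup>2 = c" for k
  proof -
    have "\<gamma> (right (right k)) + \<gamma> (up k)
        = (\<Sum>j\<in>UNIV. ((s j)\<^sup>2 + t j) * (s j ^ fst k * t j ^ snd k)) / 2"
      by (simp add: two_atomic_moment_def UNIV_bool power2_eq_square field_simps)
    also have "\<dots> = c * \<gamma> k"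
      by (simp add: assms two_atomic_moment_def sum_distrib_left)
    finally show ?thesis
      using \<gamma>_pos[of k] \<gamma>_pos[of "right k"]
      by (simp add: power_mult_distrib \<alpha>_squared \<beta>_squared add_divide_distrib[symmetric])
  qed
  then show ?thesis
    using comm unfolding wshift_comp[OF right_\<alpha> right_\<alpha>]
    by (intro spherically_quasinormal_wshift[OF r up_\<beta>])
qed

text \<open>The mirror image of the preceding argument, with the two coordinates exchanged.\<close>

lemma spherically_quasinormal_T2_squared:
  assumes "\<And>j. s j + (t j)\<^sup>2 = c"
  shows "spherically_quasinormal T1 (T2 \<circ> T2)"
proof -
  note r = inj_compose[OF inj_up inj_up]
    bounded_range_mult[OF bounded_range_comp[OF bounded_\<beta>] bounded_\<beta>]
  have "T1 \<circ> (T2 \<circ> T2) = T2 \<circ> T2 \<circ> T1"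
    by (simp only: comp_assoc[symmetric] T1_T2_commute) (simp only: comp_assoc T1_T2_commute)
  then have comm: "commuting_pair T1 (T2 \<circ> T2)"
    by (simp add: commuting_pair_def wshift_comp[OF up_\<beta> up_\<beta>] bounded_clinear_wshift[OF r]
        bounded_clinear_wshift[OF right_\<alpha>])
  have "(\<alpha> k)\<^sup>2 + (\<beta> (up k) * \<beta> k)\<^sup>2 = c" for k
  proof -
    have "\<gamma> (right k) + \<gamma> (up (up k))
        = (\<Sum>j\<in>UNIV. (s j + (t j)\<^sup>2) * (s j ^ fst k * t j ^ snd k)) / 2"
      by (simp add: two_atomic_moment_def UNIV_bool power2_eq_square field_simps)
    also have "\<dots> = c * \<gamma> k"
      by (simp add: assms two_atomic_moment_def sum_distrib_left)
    finally show ?thesis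
      using \<gamma>_pos[of k] \<gamma>_pos[of "up k"]
      by (simp add: power_mult_distrib \<alpha>_squared \<beta>_squared add_divide_distrib[symmetric])
  qed
  then show ?thesis
    using comm unfolding wshift_comp[OF up_\<beta> up_\<beta>]
    by (intro spherically_quasinormal_wshift[OF right_\<alpha> r])
qed

end

section \<open>The concrete pair of atoms\<close>

theorem theorem3p13:
  shows "\<exists>(\<alpha> :: nat \<times> nat \<Rightarrow> real) (\<beta> :: nat \<times> nat \<Rightarrow> real) T1 T2.
    two_variable_weighted_shift \<alpha> \<beta> T1 T2 \<and>
    subnormal_pair T1 T2 \<and>
    (\<exists>\<mu>. berger_measure \<alpha> \<beta> T1 T2 \<mu> \<and> two_atomic \<mu>) \<and>
    spherically_quasinormal (T1 \<circ> T1) T2 \<and>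
    spherically_quasinormal T1 (T2 \<circ> T2) \<and>
    \<not> spherically_quasinormal T1 T2"
proof -
  \<comment> \<open>Here \<open>s\<close> sums to 2 and \<open>t\<close> to 1/2, with product 1, and
    the squares of \<open>s\<close> differ by 1/4, which the difference of the values of
    \<open>t\<close> offsets. But \<open>s + t\<close> is 19/16 at one atom and 21/16 at the
    other.\<close>
  define s t :: "bool \<Rightarrow> real"
    where "s j = (if j then 17/16 else 15/16)" and "t j = (if j then 1/8 else 3/8)" for j
  interpret two_atoms s t
    by unfold_locales (simp_all add: s_def t_def)
  have "spherically_quasinormal (T1 \<circ> T1) T2"
    by (rule spherically_quasinormal_T1_squared[where c = "321/256"])
      (simp add: s_def t_def power2_eq_square)
  moreover have "spherically_quasinormal T1 (T2 \<circ> T2)"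
    by (rule spherically_quasinormal_T2_squared[where c = "69/64"])
      (simp add: s_def t_def power2_eq_square)
  moreover have "\<not> spherically_quasinormal T1 T2"
  proof
    assume "spherically_quasinormal T1 T2"
    \<comment> \<open>The diagonal entry is 5/4 = 320/256 at \<open>(0, 0)\<close>, but 319/256 at
      \<open>(1, 0)\<close>.\<close>
    from spherically_quasinormal_wshiftD[OF right_\<alpha> up_\<beta> this, of "(0, 0)"]
    show False
      using \<alpha>_pos[of "(0, 0)"]
      by (simp add: \<alpha>_squared \<beta>_squared two_atomic_moment_def UNIV_bool s_def t_def
          power_divide)
  qed
  moreover have "two_atomic \<mu>"
    by (rule two_atomic_\<mu>) (simp add: s_def)
  ultimately show ?thesis
    using two_variable_weighted_shift_T subnormal_pair_T berger_measure_\<mu> by blast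
qed

end
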